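(* Let $\mathcal{A}$ be a factorial design with $n$ runs in the design space $\mathcal{D}$, where $\mathcal{D}$ has $N = s_1 s_2\cdots s_k$ points, and let $\{C_{\mathbf{t}}(\mathbf{x}), \mathbf{t}\in\mathcal{T}\}$ be an orthonormal contrast basis (OCB) on $\mathcal{D}$. Then the indicator function $F_{\mathcal{A}}$ of $\mathcal{A}$ can be represented as a linear combination of the $C_{\mathbf{t}}$'s, $$F_{\mathcal{A}}(\mathbf{x}) = \sum_{\mathbf{t}\in\mathcal{T}} b_{\mathbf{t}} C_{\mathbf{t}}(\mathbf{x})\quad\text{for all } \mathbf{x}\in\mathcal{D},$$ and the real coefficients $\{b_{\mathbf{t}}, \mathbf{t}\in\mathcal{T}\}$ are uniquely determined as $$b_{\mathbf{t}} = \frac{1}{N}\sum_{\mathbf{x}\in\mathcal{A}} C_{\mathbf{t}}(\mathbf{x}).$$ In particular, if $\{C_{\mathbf{t}}\}$ is a statistical orthonormal contrast basis (SOCB), then $b_{\mathbf{0}} = n/N$, where $\mathbf{0} = (0,0,\ldots,0)$.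
   Context: Let $k\ge 1$ and let $s_1,\ldots,s_k$ be positive integers, $G_i=\{0,1,\ldots,s_i-1\}\subset\mathbb{R}$. The design space is $\mathcal{D}=G_1\times\cdots\times G_k\subset\mathbb{R}^k$ (the full factorial design), with $N=s_1\cdots s_k$ points. The index set is $\mathcal{T}=G_1\times\cdots\times G_k$. A factorial design $\mathcal{A}$ in $\mathcal{D}$ with $n$ runs is a finite multiset of $n$ points of $\mathcal{D}$ (a point may appear more than once); sums $\sum_{\mathbf{x}\in\mathcal{A}}$ are taken with multiplicity. The indicator function $F_{\mathcal{A}}:\mathcal{D}\to\mathbb{R}$ assigns to $\mathbf{x}$ the number of appearances of $\mathbf{x}$ in $\mathcal{A}$. For each $i$, let $C^i_0,\ldots,C^i_{s_i-1}:G_i\to\mathbb{R}$ be functions with $\sum_{x\in G_i} C^i_u(x)C^i_v(x) = 0$ if $u\ne v$ and $=s_i$ if $u=v$. The associated orthonormal contrast basis (OCB) is the family $C_{\mathbf{t}}(\mathbf{x})=\prod_{i=1}^k C^i_{t_i}(x_i)$, $\mathbf{t}\in\mathcal{T}$, $\mathbf{x}\in\mathcal{D}$. It is a statistical orthonormal contrast basis (SOCB) if $C^i_0\equiv 1$ for all $i$. *)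

theory Defs
  imports "HOL-Analysis.Analysis" "HOL-Library.Multiset"
begin

text \<open>
  The factors are indexed by a finite type \<open>'k\<close>, so the number of factors is \<open>CARD('k) \<ge> 1\<close>,
  and \<open>s i\<close> is the number of levels of factor \<open>i\<close>.  Design points have real coordinates; the
  index set consists of the same tuples, with coordinates kept as natural numbers.
\<close>

definition levels :: "nat \<Rightarrow> real set" where
  "levels m = real ` {..<m}"

definition design_space :: "('k::finite \<Rightarrow> nat) \<Rightarrow> (real ^ 'k) set" where
  "design_space s = {x. \<forall>i. x $ i \<in> levels (s i)}"

definition index_set :: "('k::finite \<Rightarrow> nat) \<Rightarrow> (nat ^ 'k) set" where
  "index_set s = {t. \<forall>i. t $ i < s i}"

definition num_points :: "('k::finite \<Rightarrow> nat) \<Rightarrow> nat" where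
  "num_points s = (\<Prod>i\<in>UNIV. s i)"

definition factorial_design :: "('k::finite \<Rightarrow> nat) \<Rightarrow> nat \<Rightarrow> (real ^ 'k) multiset \<Rightarrow> bool" where
  "factorial_design s n A \<longleftrightarrow> set_mset A \<subseteq> design_space s \<and> size A = n"

definition indicator_function :: "(real ^ 'k::finite) multiset \<Rightarrow> real ^ 'k \<Rightarrow> real" where
  "indicator_function A x = real (count A x)"

text \<open>
  \<open>c i u\<close> is the univariate contrast \<open>C\<^sup>i\<^sub>u\<close>.  It is a total function on the reals, but only its
  values on \<open>levels (s i)\<close>, for \<open>u < s i\<close>, are constrained or used.
\<close>

definition contrast :: "('k::finite \<Rightarrow> nat \<Rightarrow> real \<Rightarrow> real) \<Rightarrow> nat ^ 'k \<Rightarrow> real ^ 'k \<Rightarrow> real" where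
  "contrast c t x = (\<Prod>i\<in>UNIV. c i (t $ i) (x $ i))"

definition OCB :: "('k::finite \<Rightarrow> nat) \<Rightarrow> ('k \<Rightarrow> nat \<Rightarrow> real \<Rightarrow> real) \<Rightarrow> bool" where
  "OCB s c \<longleftrightarrow> (\<forall>i. \<forall>u<s i. \<forall>v<s i.
     (\<Sum>x\<in>levels (s i). c i u x * c i v x) = (if u = v then real (s i) else 0))"

definition SOCB :: "('k::finite \<Rightarrow> nat) \<Rightarrow> ('k \<Rightarrow> nat \<Rightarrow> real \<Rightarrow> real) \<Rightarrow> bool" where
  "SOCB s c \<longleftrightarrow> OCB s c \<and> (\<forall>i. \<forall>x\<in>levels (s i). c i 0 x = 1)"

end

theory Submission
  imports Defs
begin

text \<open>
  The contrasts are orthogonal as functions on the design space, and there are as many of them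
  as design points.  Hence the kernel \<open>\<Sum>\<^sub>t C\<^sub>t(x) C\<^sub>t(y)\<close> is \<open>N\<close> times an orthogonal projection of
  full trace, i.e. \<open>N\<close> times the identity.  Applying it to the indicator function gives the
  expansion; pairing an expansion with \<open>C\<^sub>t\<close> recovers its coefficients.
\<close>

lemma orthogonal_dual:
  fixes f :: "'a \<Rightarrow> 'b \<Rightarrow> real"
  assumes X: "finite X" and T: "finite T" and card: "card T = card X" and N: "N > 0"
    and orth: "\<And>u v. u \<in> T \<Longrightarrow> v \<in> T \<Longrightarrow> (\<Sum>x\<in>X. f u x * f v x) = (if u = v then N else 0)"
    and x: "x \<in> X" and y: "y \<in> X"
  shows "(\<Sum>u\<in>T. f u x * f u y) = (if x = y then N else 0)"
proof -
  define K where "K = (\<lambda>x y. \<Sum>u\<in>T. f u x * f u y)"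
  \<comment> \<open>Since \<open>K\<close> is symmetric, this is the diagonal of the matrix identity
    K^2 = N K. Summing over \<open>w\<close> first, orthogonality keeps only the terms with
    \<open>u = v\<close>.\<close>
  have K2: "(\<Sum>w\<in>X. (K z w)\<^sup>2) = N * K z z" for z
  proof -
    have "(\<Sum>w\<in>X. (K z w)\<^sup>2) = (\<Sum>w\<in>X. \<Sum>u\<in>T. \<Sum>v\<in>T. f u z * f v z * (f u w * f v w))"
      unfolding K_def power2_eq_square sum_product by (simp add: mult_ac)
    also have "\<dots> = (\<Sum>u\<in>T. \<Sum>v\<in>T. \<Sum>w\<in>X. f u z * f v z * (f u w * f v w))"
      by (subst sum.swap, intro sum.cong refl sum.swap)
    also have "\<dots> = (\<Sum>u\<in>T. \<Sum>v\<in>T. if u = v then f u z * f v z * N else 0)"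
      by (intro sum.cong refl) (simp add: orth flip: sum_distrib_left)
    also have "\<dots> = N * K z z"
      using T by (simp add: K_def sum_distrib_left mult_ac)
    finally show ?thesis .
  qed
  have diag_le: "K z z \<le> N" if "z \<in> X" for z
  proof -
    \<comment> \<open>The term \<open>w = z\<close> of the sum in \<open>K2\<close> is bounded by
      the whole sum.\<close>
    have "(K z z)\<^sup>2 \<le> N * K z z"
      unfolding K2[symmetric] using X that by (intro member_le_sum) auto
    moreover have "K z z \<ge> 0"
      unfolding K_def by (intro sum_nonneg) auto
    ultimately show ?thesis
      using N by (cases "K z z = 0") (auto simp: power2_eq_square)
  qed
  \<comment> \<open>The trace counts \<open>N\<close> once for each function; equal cardinalities
    make it the largest value that \<open>diag_le\<close> allows, so every diagonal entry attains
    its bound.\<close>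
  have "(\<Sum>z\<in>X. K z z) = (\<Sum>u\<in>T. \<Sum>z\<in>X. f u z * f u z)"
    unfolding K_def by (rule sum.swap)
  also have "\<dots> = (\<Sum>z\<in>X. N)"
    by (simp add: orth card)
  finally have trace: "(\<Sum>z\<in>X. K z z) = (\<Sum>z\<in>X. N)" .
  have diag: "K x x = N"
    using sum_mono_inv[OF trace diag_le x X] .
  have "K x y = 0" if "x \<noteq> y"
  proof -
    \<comment> \<open>In \<open>K2\<close> the term \<open>w = x\<close> is N^2, which already
      exhausts the right-hand side.\<close>
    have "(\<Sum>w\<in>X - {x}. (K x w)\<^sup>2) = 0"
      using K2[of x] X x by (simp add: sum_diff1 diag power2_eq_square)
    then show ?thesis
      using X y that by (subst (asm) sum_nonneg_eq_0_iff) auto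
  qed
  with diag show ?thesis
    unfolding K_def by auto
qed

text \<open>Over \<open>UNIV\<close> the extensionality condition in \<open>Pi\<^sub>E\<close> is
  vacuous. The bijection carries finiteness, cardinality and sums from function spaces over to
  vectors.\<close>

lemma bij_betw_vec_lambda:
  "bij_betw vec_lambda (Pi\<^sub>E UNIV B) {x. \<forall>i. x $ i \<in> B i}"
  by (rule bij_betwI[where g = vec_nth]) auto

lemma finite_vec_box:
  fixes B :: "'k::finite \<Rightarrow> 'a set"
  assumes "\<And>i. finite (B i)"
  shows "finite {x. \<forall>i. x $ i \<in> B i}"
  using bij_betw_finite[OF bij_betw_vec_lambda[of B]] assms by (simp add: finite_PiE)

lemma card_vec_box:
  fixes B :: "'k::finite \<Rightarrow> 'a set"
  shows "card {x. \<forall>i. x $ i \<in> B i} = (\<Prod>i\<in>UNIV. card (B i))"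
  using bij_betw_same_card[OF bij_betw_vec_lambda[of B]] by (simp add: card_PiE)

text \<open>Distributivity: expanding the product of sums chooses one \<open>y\<close> per
  coordinate, that is, one vector of the box. This reduces orthogonality on the design space to the
  single factors.\<close>

lemma sum_vec_box_prod:
  fixes B :: "'k::finite \<Rightarrow> 'a set" and g :: "'k \<Rightarrow> 'a \<Rightarrow> 'b::comm_semiring_1"
  assumes "\<And>i. finite (B i)"
  shows "(\<Sum>x | \<forall>i. x $ i \<in> B i. \<Prod>i\<in>UNIV. g i (x $ i)) = (\<Prod>i\<in>UNIV. \<Sum>y\<in>B i. g i y)"
  using assms
  by (subst prod_sum_PiE) (auto simp flip: sum.reindex_bij_betw[OF bij_betw_vec_lambda[of B]])

lemma sum_mset_eq_sum_count:
  fixes g :: "'a \<Rightarrow> real"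
  assumes "finite X" and "set_mset A \<subseteq> X"
  shows "(\<Sum>x\<in>#A. g x) = (\<Sum>x\<in>X. real (count A x) * g x)"
  using assms(2)
proof (induction A)
  case (add a A)
  \<comment> \<open>Only the multiplicity of \<open>a\<close> changes, and \<open>a\<close> lies in
    \<open>X\<close>, so exactly one extra \<open>g a\<close> appears.\<close>
  have "(\<Sum>x\<in>X. real (count (add_mset a A) x) * g x)
      = (\<Sum>x\<in>X. real (count A x) * g x + (if x = a then g x else 0))"
    by (intro sum.cong) (auto simp: algebra_simps)
  with add assms(1) show ?case
    by (simp add: sum.distrib)
qed simp

lemma finite_levels [simp]: "finite (levels m)"
  and card_levels [simp]: "card (levels m) = m"
  by (simp_all add: levels_def card_image)

lemma finite_design_space [simp]: "finite (design_space s)"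
  unfolding design_space_def by (rule finite_vec_box) simp

lemma card_design_space: "card (design_space s) = num_points s"
  unfolding design_space_def num_points_def by (simp add: card_vec_box)

lemma finite_index_set [simp]: "finite (index_set s)"
  unfolding index_set_def using finite_vec_box[of "\<lambda>i. {..<s i}"] by simp

lemma card_index_set: "card (index_set s) = num_points s"
  unfolding index_set_def num_points_def using card_vec_box[of "\<lambda>i. {..<s i}"] by simp

lemma contrast_orthogonal:
  assumes ocb: "OCB s c" and t: "t \<in> index_set s" and u: "u \<in> index_set s"
  shows "(\<Sum>x\<in>design_space s. contrast c t x * contrast c u x)
       = (if t = u then real (num_points s) else 0)"
proof -
  have "(\<Sum>x\<in>design_space s. contrast c t x * contrast c u x)
      = (\<Prod>i\<in>UNIV. \<Sum>y\<in>levels (s i). c i (t $ i) y * c i (u $ i) y)"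
    unfolding design_space_def contrast_def
    using sum_vec_box_prod[of "\<lambda>i. levels (s i)" "\<lambda>i y. c i (t $ i) y * c i (u $ i) y"]
    by (simp flip: prod.distrib)
  also have "\<dots> = (\<Prod>i\<in>UNIV. if t $ i = u $ i then real (s i) else 0)"
    using ocb t u by (intro prod.cong) (auto simp: OCB_def index_set_def)
  \<comment> \<open>Distinct indices differ in some coordinate, whose zero factor kills the
    product.\<close>
  also have "\<dots> = (if t = u then real (num_points s) else 0)"
    by (auto simp: num_points_def vec_eq_iff)
  finally show ?thesis .
qed

theorem theorem2p1:
  fixes s :: "'k::finite \<Rightarrow> nat"
    and c :: "'k \<Rightarrow> nat \<Rightarrow> real \<Rightarrow> real"
    and A :: "(real ^ 'k) multiset"
    and n :: nat
  assumes s_pos: "\<And>i. s i > 0"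
    and design: "factorial_design s n A"
    and ocb: "OCB s c"
  shows "\<exists>b :: nat ^ 'k \<Rightarrow> real.
      (\<forall>x\<in>design_space s.
         indicator_function A x = (\<Sum>t\<in>index_set s. b t * contrast c t x)) \<and>
      (\<forall>b' :: nat ^ 'k \<Rightarrow> real.
         (\<forall>x\<in>design_space s.
            indicator_function A x = (\<Sum>t\<in>index_set s. b' t * contrast c t x)) \<longrightarrow>
         (\<forall>t\<in>index_set s. b' t = b t)) \<and>
      (\<forall>t\<in>index_set s. b t = 1 / real (num_points s) * (\<Sum>x\<in>#A. contrast c t x)) \<and>
      (SOCB s c \<longrightarrow> b 0 = real n / real (num_points s))"
proof -
  define N where "N = real (num_points s)"
  define F where "F = indicator_function A"
  have N: "N > 0"
    using s_pos by (simp add: N_def num_points_def prod_pos)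
  have orth: "(\<Sum>x\<in>design_space s. contrast c t x * contrast c u x) = (if t = u then N else 0)"
    if "t \<in> index_set s" "u \<in> index_set s" for t u
    using contrast_orthogonal[OF ocb that] by (simp add: N_def)
  have dual: "(\<Sum>t\<in>index_set s. contrast c t x * contrast c t y) = (if x = y then N else 0)"
    if "x \<in> design_space s" "y \<in> design_space s" for x y
    using that N orth by (intro orthogonal_dual[where X = "design_space s"])
      (auto simp: card_design_space card_index_set)
  have A: "set_mset A \<subseteq> design_space s" and n: "size A = n"
    using design by (auto simp: factorial_design_def)
  have sum_A: "(\<Sum>x\<in>#A. g x) = (\<Sum>x\<in>design_space s. F x * g x)" for g
    using sum_mset_eq_sum_count[OF _ A] by (simp add: F_def indicator_function_def)
  define b where "b = (\<lambda>t. 1 / N * (\<Sum>x\<in>#A. contrast c t x))"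
  have expansion: "F x = (\<Sum>t\<in>index_set s. b t * contrast c t x)" if x: "x \<in> design_space s" for x
  proof -
    have "(\<Sum>t\<in>index_set s. b t * contrast c t x)
        = (\<Sum>t\<in>index_set s. \<Sum>y\<in>design_space s. F y / N * (contrast c t y * contrast c t x))"
      by (simp add: b_def sum_A sum_distrib_left sum_distrib_right mult_ac)
    \<comment> \<open>Exchanging the sums exposes the kernel, which \<open>dual\<close> evaluates to
      \<open>N\<close> at \<open>y = x\<close> and to zero elsewhere.\<close>
    also have "\<dots> = (\<Sum>y\<in>design_space s. F y / N * (\<Sum>t\<in>index_set s. contrast c t y * contrast c t x))"
      unfolding sum_distrib_left by (rule sum.swap)
    also have "\<dots> = (\<Sum>y\<in>design_space s. if y = x then F y else 0)"
      using N x by (intro sum.cong) (auto simp: dual)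
    also have "\<dots> = F x"
      using x by simp
    finally show ?thesis ..
  qed
  have unique: "b' t = b t"
    if b': "\<forall>x\<in>design_space s. F x = (\<Sum>u\<in>index_set s. b' u * contrast c u x)"
      and t: "t \<in> index_set s" for b' t
  proof -
    \<comment> \<open>Pairing the assumed expansion with \<open>contrast c t\<close> isolates
      \<open>b' t\<close>, by \<open>orth\<close> alone.\<close>
    have "(\<Sum>x\<in>#A. contrast c t x)
        = (\<Sum>x\<in>design_space s. \<Sum>u\<in>index_set s. b' u * (contrast c u x * contrast c t x))"
      unfolding sum_A using b' by (intro sum.cong) (auto simp: sum_distrib_right mult.assoc)
    also have "\<dots> = (\<Sum>u\<in>index_set s. b' u * (\<Sum>x\<in>design_space s. contrast c u x * contrast c t x))"
      unfolding sum_distrib_left by (rule sum.swap)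
    also have "\<dots> = (\<Sum>u\<in>index_set s. if u = t then b' u * N else 0)"
      using t by (intro sum.cong) (auto simp: orth)
    also have "\<dots> = b' t * N"
      using t by simp
    finally show ?thesis
      using N by (simp add: b_def)
  qed
  have "b 0 = real n / N" if "SOCB s c"
  proof -
    \<comment> \<open>The contrasts \<open>c i 0\<close> are known to be 1 only on the levels, hence
      the restriction to points of \<open>A\<close>. The sum then counts these points with
      multiplicity.\<close>
    have "contrast c 0 x = 1" if "x \<in># A" for x
      using that A \<open>SOCB s c\<close> by (auto simp: contrast_def SOCB_def design_space_def)
    then have "(\<Sum>x\<in>#A. contrast c 0 x) = (\<Sum>x\<in>#A. 1)"
      by (intro arg_cong[where f = sum_mset] image_mset_cong)
    then show ?thesis
      by (simp add: b_def n)
  qed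
  with expansion unique show ?thesis
    unfolding F_def N_def by (intro exI[of _ b]) (auto simp: b_def N_def)
qed

end
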